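(* Let $\mathbb{F}_q$ be a finite field with $q$ elements, let $a\in\mathbb{F}_q^{\times}$, and write $t:=q^{-s}$. For the Lie algebras over $\mathbb{F}_q$ defined in the context, the ideal zeta functions are \begin{align*} \zeta_{L_{1,1}(\mathbb{F}_q)}^{\triangleleft}(s)&=1+t,\\ \zeta_{L_{2,1}(\mathbb{F}_q)}^{\triangleleft}(s)&=1+(1+q)t+t^2,\\ \zeta_{L_{2,2}(\mathbb{F}_q)}^{\triangleleft}(s)&=1+t+t^2,\\ \zeta_{L^{1}(\mathbb{F}_q)}^{\triangleleft}(s)&=1+(1+q+q^2)t+(1+q+q^2)t^2+t^3,\\ \zeta_{L^{2}(\mathbb{F}_q)}^{\triangleleft}(s)&=1+t+(1+q)t^2+t^3,\\ \zeta_{L_a^{3}(\mathbb{F}_q)}^{\triangleleft}(s)&=1+t+|V_{3,a}(\mathbb{F}_q)|t^2+t^3,\\ \zeta_{L_0^{3}(\mathbb{F}_q)}^{\triangleleft}(s)&=1+(1+q)t+2t^2+t^3,\\ \zeta_{L_a^{4}(\mathbb{F}_q)}^{\triangleleft}(s)&=1+t+|V_{4,a}(\mathbb{F}_q)|t^2+t^3,\\ \zeta_{L_0^{4}(\mathbb{F}_q)}^{\triangleleft}(s)&=1+(1+q)t+t^2+t^3. \end{align*}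
   Context: For a Lie algebra $L$ over $\mathbb{F}_q$ of finite dimension $n$, the ideal zeta function is $\zeta_L^{\triangleleft}(s)=\sum_{i=0}^{n}a^{\triangleleft}_{q^i}(L)\,t^{i}$, where $t=q^{-s}$ and $a^{\triangleleft}_{q^i}(L)$ is the number of ideals of $L$ of codimension $i$ (index $q^i$). The Lie algebras below are given by an $\mathbb{F}_q$-basis $e_1,e_2,\dots$ and brackets; up to antisymmetry all brackets of basis elements that are not listed are zero. - $L_{1,1}(\mathbb{F}_q)$: basis $e_1$, abelian. - $L_{2,1}(\mathbb{F}_q)$: basis $e_1,e_2$, abelian. - $L_{2,2}(\mathbb{F}_q)$: basis $e_1,e_2$, $[e_1,e_2]=e_2$. - $L^1(\mathbb{F}_q)$: basis $e_1,e_2,e_3$, abelian. - $L^2(\mathbb{F}_q)$: basis $e_1,e_2,e_3$, $[e_3,e_1]=e_1$, $[e_3,e_2]=e_2$. - $L_a^3(\mathbb{F}_q)$ (for $a\in\mathbb{F}_q$): basis $e_1,e_2,e_3$, $[e_3,e_1]=e_2$, $[e_3,e_2]=ae_1+e_2$. - $L_a^4(\mathbb{F}_q)$ (for $a\in\mathbb{F}_q$): basis $e_1,e_2,e_3$, $[e_3,e_1]=e_2$, $[e_3,e_2]=ae_1$. Moreover $|V_{3,a}(\mathbb{F}_q)|=|\{x\in\mathbb{F}_q: ax^2-x-1=0\}|$ and $|V_{4,a}(\mathbb{F}_q)|=|\{x\in\mathbb{F}_q: ax^2-1=0\}|$. *)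

theory Defs
  imports "HOL-Analysis.Analysis"
begin

locale lie_algebra = vector_space scale
  for scale :: "'f::field \<Rightarrow> 'v::ab_group_add \<Rightarrow> 'v" (infixr "*L" 75) +
  fixes bracket :: "'v \<Rightarrow> 'v \<Rightarrow> 'v"
  assumes bracket_add_left: "bracket (x + y) z = bracket x z + bracket y z"
    and bracket_add_right: "bracket x (y + z) = bracket x y + bracket x z"
    and bracket_scale_left: "bracket (c *L x) y = c *L bracket x y"
    and bracket_scale_right: "bracket x (c *L y) = c *L bracket x y"
    and bracket_self: "bracket x x = 0"
    and jacobi: "bracket x (bracket y z) + bracket y (bracket z x) + bracket z (bracket x y) = 0"
begin

definition lie_ideal :: "'v set \<Rightarrow> bool" where
  "lie_ideal I \<longleftrightarrow> subspace I \<and> (\<forall>x. \<forall>y\<in>I. bracket x y \<in> I)"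

definition num_ideals_codim :: "nat \<Rightarrow> nat" where
  "num_ideals_codim i = card {I. lie_ideal I \<and> dim I + i = dim UNIV}"

end

locale fin_dim_lie_algebra_Fq = lie_algebra scale bracket
  for scale :: "'f::{field,finite} \<Rightarrow> 'v::ab_group_add \<Rightarrow> 'v" (infixr "*L" 75)
    and bracket :: "'v \<Rightarrow> 'v \<Rightarrow> 'v" +
  assumes fin_dim: "\<exists>B. finite B \<and> span B = UNIV"
begin

definition ideal_zeta :: "complex \<Rightarrow> complex" where
  "ideal_zeta s = (\<Sum>i\<le>dim UNIV. of_nat (num_ideals_codim i) * (of_nat CARD('f) powr (-s)) ^ i)"

end

abbreviation basis_e :: "'n::finite \<Rightarrow> 'f::field ^ 'n" where
  "basis_e i \<equiv> axis i 1"

text \<open>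
  The table \<open>T\<close> contains the listed brackets of basis vectors and is zero elsewhere. Of
  \<open>T i j\<close> and \<open>T j i\<close> at most one is nonzero, and \<open>T i i = 0\<close>; hence \<open>T i j - T j i\<close>
  is the bracket of \<open>basis_e i\<close> and \<open>basis_e j\<close> determined by the table and antisymmetry.
\<close>
definition bracket_of :: "('n \<Rightarrow> 'n \<Rightarrow> 'f ^ 'n) \<Rightarrow> 'f::field ^ 'n \<Rightarrow> 'f ^ 'n \<Rightarrow> 'f ^ 'n" where
  "bracket_of T x y = (\<Sum>i\<in>UNIV. \<Sum>j\<in>UNIV. (x $ i * y $ j) *s (T i j - T j i))"

text \<open>
  A Lie algebra on coordinate space is represented by its bracket. The index \<open>3\<close> of type
  \<open>3\<close> is the residue class \<open>0\<close>, and likewise for \<open>2\<close> of type \<open>2\<close>.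
\<close>
definition L11 :: "'f::field ^ 1 \<Rightarrow> 'f ^ 1 \<Rightarrow> 'f ^ 1" where
  "L11 = bracket_of (\<lambda>i j. 0)"

definition L21 :: "'f::field ^ 2 \<Rightarrow> 'f ^ 2 \<Rightarrow> 'f ^ 2" where
  "L21 = bracket_of (\<lambda>i j. 0)"

definition L22 :: "'f::field ^ 2 \<Rightarrow> 'f ^ 2 \<Rightarrow> 'f ^ 2" where
  "L22 = bracket_of (\<lambda>i j. if (i, j) = (1, 2) then basis_e 2 else 0)"

definition L1 :: "'f::field ^ 3 \<Rightarrow> 'f ^ 3 \<Rightarrow> 'f ^ 3" where
  "L1 = bracket_of (\<lambda>i j. 0)"

definition L2 :: "'f::field ^ 3 \<Rightarrow> 'f ^ 3 \<Rightarrow> 'f ^ 3" where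
  "L2 = bracket_of
     (\<lambda>i j. if (i, j) = (3, 1) then basis_e 1
       else if (i, j) = (3, 2) then basis_e 2 else 0)"

definition L3 :: "'f \<Rightarrow> 'f::field ^ 3 \<Rightarrow> 'f ^ 3 \<Rightarrow> 'f ^ 3" where
  "L3 a = bracket_of
     (\<lambda>i j. if (i, j) = (3, 1) then basis_e 2
       else if (i, j) = (3, 2) then a *s basis_e 1 + basis_e 2 else 0)"

definition L4 :: "'f \<Rightarrow> 'f::field ^ 3 \<Rightarrow> 'f ^ 3 \<Rightarrow> 'f ^ 3" where
  "L4 a = bracket_of
     (\<lambda>i j. if (i, j) = (3, 1) then basis_e 2
       else if (i, j) = (3, 2) then a *s basis_e 1 else 0)"

definition V3 :: "'f::field \<Rightarrow> 'f set" where
  "V3 a = {x. a * x ^ 2 - x - 1 = 0}"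

definition V4 :: "'f::field \<Rightarrow> 'f set" where
  "V4 a = {x. a * x ^ 2 - 1 = 0}"

abbreviation zeta_of :: "('f::{field,finite} ^ 'n \<Rightarrow> 'f ^ 'n \<Rightarrow> 'f ^ 'n) \<Rightarrow> complex \<Rightarrow> complex" where
  "zeta_of br \<equiv> fin_dim_lie_algebra_Fq.ideal_zeta (*s) br"

lemma bracket_of_basis:
  fixes T :: "'n::finite \<Rightarrow> 'n \<Rightarrow> 'f::field ^ 'n"
  shows "bracket_of T (basis_e i) (basis_e j) = T i j - T j i"
proof -
  have "bracket_of T (basis_e i) (basis_e j)
      = (\<Sum>k\<in>UNIV. \<Sum>l\<in>UNIV. if l = j then if k = i then T k l - T l k else 0 else 0)"
    unfolding bracket_of_def by (intro sum.cong refl) (auto simp: axis_def)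
  then show ?thesis by simp
qed

lemma bracket_of_self: "bracket_of T x x = (0 :: 'f::field ^ 'n)"
proof -
  have "bracket_of T x x = (\<Sum>i\<in>UNIV. \<Sum>j\<in>UNIV. (x $ i * x $ j) *s T i j)
      - (\<Sum>i\<in>UNIV. \<Sum>j\<in>UNIV. (x $ i * x $ j) *s T j i)"
    by (simp add: bracket_of_def vec.scale_right_diff_distrib sum_subtractf)
  also have "(\<Sum>i\<in>UNIV. \<Sum>j\<in>UNIV. (x $ i * x $ j) *s T j i)
      = (\<Sum>i\<in>UNIV. \<Sum>j\<in>UNIV. (x $ i * x $ j) *s T i j)"
    by (subst sum.swap) (simp add: mult.commute)
  finally show ?thesis by simp
qed

lemma fin_dim_lie_algebra_bracket_of:
  fixes T :: "'n::finite \<Rightarrow> 'n \<Rightarrow> 'f::{field,finite} ^ 'n"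
  assumes "\<And>x y z. bracket_of T x (bracket_of T y z) + bracket_of T y (bracket_of T z x)
    + bracket_of T z (bracket_of T x y) = 0"
  shows "fin_dim_lie_algebra_Fq (*s) (bracket_of T)"
proof
  show "\<exists>B :: ('f ^ 'n) set. finite B \<and> vec.span B = UNIV"
    by (intro exI[of _ cart_basis]) (simp add: finite_cart_basis)
qed (simp_all add: assms bracket_of_self, simp_all add: bracket_of_def vec.scale_left_distrib
  vec.scale_sum_right sum.distrib[symmetric] algebra_simps)

lemmas L_defs = L11_def L21_def L22_def L1_def L2_def L3_def L4_def

lemma L_brackets:
  "L22 (basis_e 1) (basis_e 2) = basis_e 2"
  "L2 (basis_e 3) (basis_e 1) = basis_e 1"
  "L2 (basis_e 3) (basis_e 2) = basis_e 2"
  "L2 (basis_e 1) (basis_e 2) = 0"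
  "L3 a (basis_e 3) (basis_e 1) = basis_e 2"
  "L3 a (basis_e 3) (basis_e 2) = a *s basis_e 1 + basis_e 2"
  "L3 a (basis_e 1) (basis_e 2) = 0"
  "L4 a (basis_e 3) (basis_e 1) = basis_e 2"
  "L4 a (basis_e 3) (basis_e 2) = a *s basis_e 1"
  "L4 a (basis_e 1) (basis_e 2) = 0"
  by (simp_all add: L_defs bracket_of_basis)

lemma fin_dim_lie_algebras:
  "fin_dim_lie_algebra_Fq (*s) L11"
  "fin_dim_lie_algebra_Fq (*s) L21"
  "fin_dim_lie_algebra_Fq (*s) L22"
  "fin_dim_lie_algebra_Fq (*s) L1"
  "fin_dim_lie_algebra_Fq (*s) L2"
  "fin_dim_lie_algebra_Fq (*s) (L3 a)"
  "fin_dim_lie_algebra_Fq (*s) (L4 a)"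
  unfolding L_defs
  by (rule fin_dim_lie_algebra_bracket_of,
      simp add: bracket_of_def sum_1 sum_2 sum_3 vec_eq_iff forall_1 forall_2 forall_3 axis_def
        algebra_simps)+

end

theory Submission
  imports Defs
begin

text \<open>
  Up to scaling, a hyperplane is the kernel of a functional \<open>w\<close> and a line is spanned by a vector
  \<open>v\<close>, and each scaling class contains exactly one vector whose first nonzero coordinate is \<open>1\<close>.
  A quotient of dimension one is abelian, so the hyperplane is an ideal iff \<open>w\<close> annihilates the
  derived algebra; the line is an ideal iff \<open>v\<close> is a common eigenvector of all inner derivations.
  In dimension at most three these are the only ideals besides \<open>0\<close> and the whole algebra. For the
  families \<open>L3\<close> and \<open>L4\<close> with \<open>a \<noteq> 0\<close> the normalized eigenvectors are \<open>(1, x, 0)\<close> with \<open>x\<close> an element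
  of \<open>V3 a\<close> and \<open>V4 a\<close>, respectively.
\<close>

section \<open>Coordinate functionals and normalized vectors\<close>

definition dot :: "'f::field ^ 'n::finite \<Rightarrow> 'f ^ 'n \<Rightarrow> 'f" where
  "dot w x = (\<Sum>i\<in>UNIV. w $ i * x $ i)"

lemma dot_linear:
  "dot w (x + y) = dot w x + dot w y" "dot w (c *s x) = c * dot w x" "dot (c *s w) x = c * dot w x"
  by (simp_all add: dot_def algebra_simps sum.distrib sum_distrib_left)

lemma dot_axis: "dot w (axis k 1) = w $ k"
  by (simp add: dot_def axis_def if_distrib cong: if_cong)

definition normalized :: "('f::field ^ 'n::{finite,linorder}) set" where
  "normalized = {v. \<exists>k. v $ k = 1 \<and> (\<forall>i<k. v $ i = 0)}"

lemma normalized_nonzero: "v \<in> normalized \<Longrightarrow> v \<noteq> 0"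
  by (auto simp: normalized_def)

lemma scale_to_normalized:
  fixes v :: "'f::field ^ 'n::{finite,linorder}"
  assumes "v \<noteq> 0"
  obtains c where "c \<noteq> 0" "c *s v \<in> normalized"
proof -
  define k where "k = Min {i. v $ i \<noteq> 0}"
  have ne: "{i. v $ i \<noteq> 0} \<noteq> {}" using assms by (auto simp: vec_eq_iff)
  have k: "v $ k \<noteq> 0" using Min_in[OF _ ne] by (simp add: k_def)
  have "v $ i = 0" if "i < k" for i
  proof (rule ccontr)
    assume "v $ i \<noteq> 0"
    then have "k \<le> i" by (simp add: k_def)
    with that show False by simp
  qed
  then have "(1 / v $ k) *s v \<in> normalized" using k by (auto simp: normalized_def)
  with k that[of "1 / v $ k"] show ?thesis by simp
qed

text \<open>Compare the leading positions \<open>k\<close> of \<open>u\<close> and \<open>l\<close>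
  of \<open>v\<close>. If \<open>k < l\<close>, then \<open>u $ k\<close> would be 0; if
  \<open>l < k\<close>, then \<open>c = 0\<close> and \<open>u\<close> would vanish. So
  \<open>k = l\<close>, and the entries there give \<open>c = 1\<close>.\<close>

lemma normalized_scale_eq:
  fixes u v :: "'f::field ^ 'n::{finite,linorder}"
  assumes "u \<in> normalized" "v \<in> normalized" "u = c *s v"
  shows "u = v"
proof -
  obtain k l where k: "u $ k = 1" "\<forall>i<k. u $ i = 0" and l: "v $ l = 1" "\<forall>i<l. v $ i = 0"
    using assms by (auto simp: normalized_def)
  have "u $ i = c * v $ i" for i using assms(3) by simp
  then have "c = 1" using k l
    by (metis linorder_neqE mult.right_neutral mult_zero_right mult_zero_left zero_neq_one)
  then show ?thesis using assms(3) by simp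
qed

section \<open>Lines as spans of normalized vectors\<close>

lemma span_singleton_iff: "x \<in> vec.span {v} \<longleftrightarrow> (\<exists>c. x = c *s v)"
  by (auto simp: vec.span_singleton)

text \<open>A basis of a line is a single nonzero vector, and rescaling it to a normalized one keeps
  its span.\<close>

lemma lines_eq_normalized_spans:
  "{I. vec.subspace I \<and> vec.dim I = 1}
    = (\<lambda>v. vec.span {v}) ` (normalized :: ('f::field ^ 'n::{finite,linorder}) set)"
proof (intro equalityI subsetI)
  fix I :: "('f, 'n) vec set" assume "I \<in> {I. vec.subspace I \<and> vec.dim I = 1}"
  then have I: "vec.subspace I" "vec.dim I = 1" by auto
  obtain B where B: "B \<subseteq> I" "vec.independent B" "I \<subseteq> vec.span B" "card B = vec.dim I"
    using vec.basis_exists by blast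
  then obtain v where v: "B = {v}" using I by (auto simp: card_1_singleton_iff)
  then have "v \<noteq> 0" using B by (auto simp: vec.dependent_single)
  then obtain c where c: "c \<noteq> 0" "c *s v \<in> normalized" by (rule scale_to_normalized)
  have "I = vec.span {v}"
    using B(1,3) v vec.span_minimal[OF B(1) I(1)] by (intro subset_antisym) simp_all
  also have "\<dots> = vec.span {c *s v}"
  proof (intro subset_antisym subsetI)
    fix x assume "x \<in> vec.span {v}"
    then obtain d where "x = (d / c) *s (c *s v)"
      using c(1) by (auto simp: span_singleton_iff)
    then show "x \<in> vec.span {c *s v}" unfolding span_singleton_iff by blast
  qed (auto simp: span_singleton_iff)
  finally show "I \<in> (\<lambda>v. vec.span {v}) ` normalized" using c(2) by (rule image_eqI)
next
  fix I assume "I \<in> (\<lambda>v. vec.span {v}) ` (normalized :: ('f, 'n) vec set)"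
  then obtain v :: "('f, 'n) vec" where "v \<in> normalized" and I: "I = vec.span {v}" by blast
  then have "vec.independent {v}" using normalized_nonzero by (simp add: vec.dependent_single)
  then show "I \<in> {I. vec.subspace I \<and> vec.dim I = 1}"
    by (simp add: I vec.dim_eq_card_independent)
qed

lemma inj_on_span_normalized: "inj_on (\<lambda>v. vec.span {v}) normalized"
proof (rule inj_onI)
  fix u v :: "'f::field ^ 'n::{finite,linorder}"
  assume uv: "u \<in> normalized" "v \<in> normalized" "vec.span {u} = vec.span {v}"
  then have "u \<in> vec.span {v}" by (metis insertI1 vec.span_base)
  then show "u = v" using uv normalized_scale_eq by (auto simp: span_singleton_iff)
qed

section \<open>Hyperplanes as kernels of functionals\<close>

lemma subspace_dot_kernel: "vec.subspace {x. dot w x = 0}"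
  by (rule vec.subspaceI) (auto simp: dot_linear, simp add: dot_def)

text \<open>The kernel together with one standard basis vector outside it spans the whole space, so
  exactly one dimension is missing.\<close>

lemma dim_dot_kernel:
  fixes w :: "'f::field ^ 'n::finite"
  assumes "w \<noteq> 0"
  shows "vec.dim {x. dot w x = 0} + 1 = CARD('n)"
proof -
  let ?H = "{x. dot w x = 0}"
  obtain k where k: "w $ k \<noteq> 0" using assms by (auto simp: vec_eq_iff)
  have sp: "vec.span ?H = ?H" by (simp add: subspace_dot_kernel vec.span_eq_iff)
  have "x \<in> vec.span (insert (axis k 1) ?H)" for x
  proof -
    have "dot w (x + (- (dot w x / w $ k)) *s axis k 1) = 0"
      unfolding dot_linear dot_axis using k by simp
    then show ?thesis
      unfolding vec.span_insert sp by (auto intro!: exI[of _ "dot w x / w $ k"])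
  qed
  then have "vec.span (insert (axis k 1) ?H) = UNIV" by blast
  then have "vec.dim (insert (axis k 1) ?H) = CARD('n)"
    by (metis vec.dim_span vec_dim_card)
  then show ?thesis using k by (simp add: vec.dim_insert sp dot_axis)
qed

text \<open>The functional is the coordinate of a basis vector outside the hyperplane.\<close>
lemma hyperplane_is_dot_kernel:
  fixes H :: "('f::field ^ 'n::finite) set"
  assumes "vec.subspace H" "vec.dim H + 1 = CARD('n)"
  obtains w where "w \<noteq> 0" "H = {x. dot w x = 0}"
proof -
  obtain B where B: "B \<subseteq> H" "vec.independent B" "H \<subseteq> vec.span B" "card B = vec.dim H"
    using vec.basis_exists by blast
  have H: "H = vec.span B"
    using B(3) vec.span_minimal[OF B(1) assms(1)] by (rule subset_antisym)
  have "H \<noteq> UNIV"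
  proof
    assume "H = UNIV"
    then show False using assms(2) by (simp add: card_cart_basis)
  qed
  then obtain u where u: "u \<notin> vec.span B" using H by auto
  define C where "C = insert u B"
  have uB: "u \<notin> B" using u vec.span_base by auto
  have indC: "vec.independent C" using u B by (simp add: C_def vec.independent_insertI)
  have finB: "finite B" using B(2) by (rule vec.finiteI_independent)
  have "card C = CARD('n)" using B uB finB assms(2) by (simp add: C_def)
  then have spC: "vec.span C = UNIV"
    using vec.card_ge_dim_independent[of C UNIV] indC by (auto simp: card_cart_basis)
  \<comment> \<open>The entries are the \<open>u\<close>-coordinates of the standard basis vectors
    over \<open>C\<close>, so by linearity \<open>dot w\<close> is the \<open>u\<close>-coordinate
    of any vector.\<close>
  define w :: "'f ^ 'n" where "w = (\<chi> i. vec.representation C (axis i 1) u)"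
  have rep: "vec.representation C x u = dot w x" for x
  proof -
    have "vec.representation C x u = vec.representation C (\<Sum>i\<in>UNIV. x $ i *s axis i 1) u"
      by (simp add: basis_expansion)
    also have "\<dots> = dot w x"
      by (simp add: vec.representation_sum[OF indC] vec.representation_scale[OF indC] spC
          dot_def w_def mult.commute)
    finally show ?thesis .
  qed
  have "vec.representation C u u = 1"
    using vec.representation_basis[OF indC, of u] by (simp add: C_def)
  then have "w \<noteq> 0" using rep by (auto simp: dot_def)
  moreover have "x \<in> H \<longleftrightarrow> dot w x = 0" for x
  proof
    \<comment> \<open>A vector in the span of \<open>B\<close> has the same coordinates over
      \<open>C\<close> as over \<open>B\<close>, and \<open>u\<close> lies outside
      \<open>B\<close>.\<close>
    assume "x \<in> H"
    then have "vec.representation C x = vec.representation B x"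
      using vec.representation_extend[OF indC, of x B] H by (auto simp: C_def)
    then show "dot w x = 0" using vec.representation_ne_zero[of B x u] uB rep by metis
  next
    assume 0: "dot w x = 0"
    have "x = (\<Sum>b\<in>C. vec.representation C x b *s b)"
      using vec.sum_representation_eq[OF indC, of x C] spC finB by (simp add: C_def)
    \<comment> \<open>The term of \<open>u\<close> drops out because its coefficient is
      \<open>dot w x = 0\<close>.\<close>
    also have "\<dots> = (\<Sum>b\<in>B. vec.representation C x b *s b)"
      using 0 rep finB uB by (simp add: C_def)
    also have "\<dots> \<in> vec.span B"
      by (intro vec.span_sum vec.span_scale vec.span_base)
    finally show "x \<in> H" using H by simp
  qed
  ultimately show ?thesis using that by blast
qed

text \<open>Multiplying a functional by a nonzero constant keeps its kernel, so it may be taken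
  normalized.\<close>

lemma hyperplanes_eq_normalized_kernels:
  "{H. vec.subspace H \<and> vec.dim H + 1 = CARD('n)}
    = (\<lambda>w. {x. dot w x = 0}) ` (normalized :: ('f::field ^ 'n::{finite,linorder}) set)"
proof (intro equalityI subsetI)
  fix H :: "('f, 'n) vec set" assume "H \<in> {H. vec.subspace H \<and> vec.dim H + 1 = CARD('n)}"
  then obtain w where w: "w \<noteq> 0" "H = {x. dot w x = 0}"
    using hyperplane_is_dot_kernel by blast
  then obtain c where "c \<noteq> 0" "c *s w \<in> normalized" using scale_to_normalized by blast
  then show "H \<in> (\<lambda>w. {x. dot w x = 0}) ` normalized"
    using w by (intro image_eqI[of _ _ "c *s w"]) (auto simp: dot_linear)
next
  fix H :: "('f, 'n) vec set" assume "H \<in> (\<lambda>w. {x. dot w x = 0}) ` normalized"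
  then obtain w :: "('f, 'n) vec" where w: "w \<in> normalized" "H = {x. dot w x = 0}"
    by blast
  then show "H \<in> {H. vec.subspace H \<and> vec.dim H + 1 = CARD('n)}"
    using dim_dot_kernel[OF normalized_nonzero[OF w(1)]] subspace_dot_kernel[of w] by simp
qed

lemma inj_on_dot_kernel_normalized: "inj_on (\<lambda>w. {x. dot w x = 0}) normalized"
proof (rule inj_onI)
  fix u v :: "'f::field ^ 'n::{finite,linorder}"
  assume uv: "u \<in> normalized" "v \<in> normalized" "{x. dot u x = 0} = {x. dot v x = 0}"
  obtain l where l: "v $ l \<noteq> 0" using normalized_nonzero[OF uv(2)] by (auto simp: vec_eq_iff)
  have "u $ i = u $ l / v $ l * v $ i" for i
  proof -
    \<comment> \<open>This vector is built to lie in the kernel of \<open>v\<close>. It then lies in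
      that of \<open>u\<close> too, which fixes the ratio of \<open>u $ i\<close> to
      \<open>v $ i\<close>.\<close>
    let ?x = "axis i 1 + (- v $ i / v $ l) *s axis l 1"
    have "dot v ?x = 0" unfolding dot_linear dot_axis using l by simp
    then have "dot u ?x = 0" using uv(3) by blast
    then show ?thesis unfolding dot_linear dot_axis using l by (simp add: field_simps)
  qed
  then have "u = (u $ l / v $ l) *s v" unfolding vec_eq_iff vector_smult_component by blast
  then show "u = v" using uv normalized_scale_eq by blast
qed

section \<open>Ideal criteria for hyperplanes and lines\<close>

context lie_algebra
begin

lemma bracket_antisym: "bracket x y = - bracket y x"
proof -
  have "bracket x y + bracket y x = 0"
    using bracket_self[of "x + y"] unfolding bracket_add_left bracket_add_right
    by (simp add: bracket_self add.commute)
  then show ?thesis by (simp add: eq_neg_iff_add_eq_0)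
qed

end

text \<open>Modulo the kernel, both arguments of a bracket are multiples of one vector outside it,
  whose bracket with itself is 0. Hence a kernel that is an ideal contains all brackets; the
  converse is immediate.\<close>

lemma dot_kernel_ideal_iff:
  fixes w :: "'f::field ^ 'n::finite"
  assumes "lie_algebra (*s) br" "w \<noteq> 0"
  shows "lie_algebra.lie_ideal (*s) br {x. dot w x = 0} \<longleftrightarrow> (\<forall>x y. dot w (br x y) = 0)"
proof -
  interpret lie_algebra "(*s)" br by fact
  obtain k where k: "w $ k \<noteq> 0" using assms(2) by (auto simp: vec_eq_iff)
  have "dot w (br x y) = 0" if I: "lie_ideal {x. dot w x = 0}" for x y
  proof -
    have br0: "dot w (br x y) = 0" if "dot w y = 0" for x y
      using I that by (auto simp: lie_ideal_def)
    let ?u = "axis k 1"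
    \<comment> \<open>Subtracting \<open>c *s ?u\<close> moves \<open>y\<close> into the kernel;
      \<open>d\<close> does the same for \<open>x\<close>.\<close>
    define c where "c = dot w y / w $ k"
    have y: "dot w (y + (- c) *s ?u) = 0"
      unfolding dot_linear dot_axis using k by (simp add: c_def)
    define d where "d = dot w x / w $ k"
    have x: "dot w (x + (- d) *s ?u) = 0"
      unfolding dot_linear dot_axis using k by (simp add: d_def)
    have neg: "dot w (- z) = - dot w z" for z by (simp add: dot_def sum_negf)
    have "dot w (br ?u (x + (- d) *s ?u)) = 0" using br0[OF x] .
    then have ux: "dot w (br ?u x) = 0"
      unfolding bracket_add_right bracket_scale_right bracket_self dot_linear by (simp add: dot_def)
    \<comment> \<open>The first summand vanishes because the kernel is an ideal, and antisymmetry
      reduces the second to \<open>ux\<close>.\<close>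
    have "dot w (br x y) = dot w (br x (y + (- c) *s ?u)) + c * dot w (br x ?u)"
      unfolding bracket_add_right bracket_scale_right dot_linear by simp
    then show ?thesis using br0[OF y] ux bracket_antisym[of x ?u] neg by simp
  qed
  then show ?thesis using subspace_dot_kernel by (auto simp: lie_ideal_def)
qed

text \<open>By linearity it suffices to test the spanning vector. The eigenvalue \<open>c\<close>
  may depend on \<open>x\<close>.\<close>

lemma span_singleton_ideal_iff:
  fixes v :: "'f::field ^ 'n::finite"
  assumes "lie_algebra (*s) br"
  shows "lie_algebra.lie_ideal (*s) br (vec.span {v}) \<longleftrightarrow> (\<forall>x. \<exists>c. br x v = c *s v)"
proof -
  interpret lie_algebra "(*s)" br by fact
  have "br x (d *s v) = (d * c) *s v" if "br x v = c *s v" for x c d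
    using that by (simp add: bracket_scale_right)
  then have "(\<forall>x. \<forall>y\<in>vec.span {v}. br x y \<in> vec.span {v}) \<longleftrightarrow> (\<forall>x. \<exists>c. br x v = c *s v)"
    unfolding vec.span_singleton by (auto simp: image_iff) (metis vec.scale_one, metis)
  then show ?thesis by (simp add: lie_ideal_def)
qed

section \<open>Numbers of ideals by codimension\<close>

context
  fixes br :: "'f::{field,finite} ^ 'n::finite \<Rightarrow> 'f ^ 'n \<Rightarrow> 'f ^ 'n"
  assumes L: "lie_algebra (*s) br"
begin

interpretation lie_algebra "(*s)" br by (rule L)

lemma num_ideals_codim_0: "lie_algebra.num_ideals_codim (*s) br 0 = 1"
proof -
  have "I = UNIV" if "lie_ideal I" "vec.dim I = CARD('n)" for I
    using that vec.dim_eq_full[of I] vec.span_eq_iff[of I]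
    by (simp add: lie_ideal_def vec.dimension_def card_cart_basis)
  then have "{I. lie_ideal I \<and> vec.dim I + 0 = vec.dim (UNIV :: ('f ^ 'n) set)} = {UNIV}"
    by (auto simp: card_cart_basis lie_ideal_def)
  then show ?thesis by (simp add: num_ideals_codim_def)
qed

lemma num_ideals_codim_full: "lie_algebra.num_ideals_codim (*s) br CARD('n) = 1"
proof -
  have "I = {0}" if "lie_ideal I" "vec.dim I = 0" for I
    using that vec.subspace_0[of I] by (auto simp: lie_ideal_def vec.dim_eq_0)
  moreover have "br x 0 = 0" for x using bracket_scale_right[of x 0 0] by simp
  ultimately have "{I. lie_ideal I \<and> vec.dim I + CARD('n) = vec.dim (UNIV :: ('f ^ 'n) set)} = {{0}}"
    by (auto simp: card_cart_basis lie_ideal_def vec.subspace_0)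
  then show ?thesis by (simp add: num_ideals_codim_def)
qed

end

context
  fixes br :: "('f::{field,finite}, 'n::{finite,linorder}) vec \<Rightarrow> ('f, 'n) vec \<Rightarrow> ('f, 'n) vec"
  assumes L: "lie_algebra (*s) br"
begin

interpretation lie_algebra "(*s)" br by (rule L)

text \<open>Normalized functionals and hyperplanes correspond bijectively through the kernel, so
  counting ideals becomes counting vectors.\<close>

lemma num_ideals_codim_1:
  "lie_algebra.num_ideals_codim (*s) br 1 = card {w \<in> normalized. \<forall>x y. dot w (br x y) = 0}"
proof -
  let ?K = "\<lambda>w::('f, 'n) vec. {x. dot w x = 0}"
  have "{I. lie_ideal I \<and> vec.dim I + 1 = vec.dim (UNIV :: ('f, 'n) vec set)}
      = {I \<in> {H. vec.subspace H \<and> vec.dim H + 1 = CARD('n)}. lie_ideal I}"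
    by (auto simp: card_cart_basis lie_ideal_def)
  also have "\<dots> = ?K ` {w \<in> normalized. \<forall>x y. dot w (br x y) = 0}"
    unfolding hyperplanes_eq_normalized_kernels
    using dot_kernel_ideal_iff[OF L] normalized_nonzero by blast
  finally show ?thesis
    by (simp only: num_ideals_codim_def)
      (intro card_image inj_on_subset[OF inj_on_dot_kernel_normalized], auto)
qed

text \<open>The condition on \<open>i\<close> makes the ideals of codimension \<open>i\<close> the
  lines, which are counted by their normalized spanning vectors.\<close>

lemma num_ideals_dim_1:
  assumes "i + 1 = CARD('n)"
  shows "lie_algebra.num_ideals_codim (*s) br i = card {v \<in> normalized. \<forall>x. \<exists>c. br x v = c *s v}"
proof -
  have "{I. lie_ideal I \<and> vec.dim I + i = vec.dim (UNIV :: ('f, 'n) vec set)}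
      = {I \<in> {I. vec.subspace I \<and> vec.dim I = 1}. lie_ideal I}"
    using assms by (auto simp: card_cart_basis lie_ideal_def)
  also have "\<dots> = (\<lambda>v. vec.span {v}) ` {v \<in> normalized. \<forall>x. \<exists>c. br x v = c *s v}"
    unfolding lines_eq_normalized_spans using span_singleton_ideal_iff[OF L] by blast
  finally show ?thesis
    by (simp only: num_ideals_codim_def)
      (intro card_image inj_on_subset[OF inj_on_span_normalized], auto)
qed

end

section \<open>Normalized vectors in dimensions two and three\<close>

text \<open>
  The numeral \<open>n\<close> of the type \<open>n\<close> is the residue class \<open>0\<close>, hence the least index.
\<close>
lemma less_2: "i < (1::2) \<longleftrightarrow> i = 2" "\<not> i < (2::2)"
  using exhaust_2[of i] by (auto simp: less_bit0_def bit0.Rep_1 bit0.Rep_numeral)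

lemma less_3: "i < (1::3) \<longleftrightarrow> i = 3" "i < (2::3) \<longleftrightarrow> i = 3 \<or> i = 1" "\<not> i < (3::3)"
  using exhaust_3[of i] by (auto simp: less_bit1_def bit1.Rep_1 bit1.Rep_numeral)

lemma exists_2: "(\<exists>i::2. P i) \<longleftrightarrow> P 1 \<or> P 2"
  by (metis exhaust_2)

lemma exists_3: "(\<exists>i::3. P i) \<longleftrightarrow> P 1 \<or> P 2 \<or> P 3"
  by (metis exhaust_3)

lemma normalized_2: "v \<in> normalized \<longleftrightarrow> v $ (2::2) = 1 \<or> v $ 2 = 0 \<and> v $ 1 = 1"
  by (auto simp: normalized_def less_2 exists_2)

text \<open>The index order is 3 < 1 < 2, so the alternatives run through the leading positions in
  that order.\<close>

lemma normalized_3: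
  "v \<in> normalized \<longleftrightarrow> v $ (3::3) = 1 \<or> v $ 3 = 0 \<and> (v $ 1 = 1 \<or> v $ 1 = 0 \<and> v $ 2 = 1)"
  by (auto simp: normalized_def less_3 exists_3)

lemma card_normalized_2:
  "card (normalized :: ('f::{field,finite} ^ 2) set) = 1 + CARD('f)"
proof -
  have eq: "(normalized :: ('f ^ 2) set) = insert (vector [1, 0]) (range (\<lambda>x. vector [x, 1]))"
    by (auto simp: normalized_2 image_iff vec_eq_iff forall_2)
  have "card (range (\<lambda>x. vector [x, 1] :: 'f ^ 2)) = CARD('f)"
    by (intro card_image injI) (simp add: vec_eq_iff forall_2)
  moreover have "vector [1, 0] \<notin> range (\<lambda>x. vector [x, 1] :: 'f ^ 2)"
    by (auto simp: vec_eq_iff forall_2)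
  ultimately show ?thesis
    by (subst eq) (simp only: card_insert_disjoint finite plus_1_eq_Suc not_False_eq_True)
qed

text \<open>Leading position 3, 1 or 2 leaves two, one or no free coordinates, which gives q^2, q
  and 1 vectors.\<close>

lemma card_normalized_3:
  "card (normalized :: ('f::{field,finite} ^ 3) set) = 1 + CARD('f) + CARD('f) ^ 2"
proof -
  let ?A = "range (\<lambda>(x, y). vector [x, y, 1] :: 'f ^ 3)"
  let ?B = "range (\<lambda>x. vector [1, x, 0] :: 'f ^ 3)"
  have eq: "(normalized :: ('f ^ 3) set) = insert (vector [0, 1, 0]) (?B \<union> ?A)"
    by (auto simp: normalized_3 image_iff vec_eq_iff forall_3)
  have "card ?B = CARD('f)"
    by (intro card_image injI) (simp add: vec_eq_iff forall_3)
  moreover have "card ?A = CARD('f \<times> 'f)"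
    by (intro card_image injI) (auto simp: vec_eq_iff forall_3)
  moreover have "?B \<inter> ?A = {}" by (auto simp: vec_eq_iff forall_3)
  moreover have "vector [0, 1, 0] \<notin> ?B \<union> ?A" by (auto simp: vec_eq_iff forall_3)
  ultimately show ?thesis
    by (subst eq, simp only: card_insert_disjoint card_Un_disjoint finite not_False_eq_True)
      (simp add: power2_eq_square)
qed

section \<open>Zeta functions in dimensions one to three\<close>

context
  fixes br :: "'f::{field,finite} ^ 'n::finite \<Rightarrow> 'f ^ 'n \<Rightarrow> 'f ^ 'n"
  assumes br: "fin_dim_lie_algebra_Fq (*s) br"
begin

interpretation fin_dim_lie_algebra_Fq "(*s)" br by (rule br)

lemma zeta_eq_sum:
  "zeta_of br s = (\<Sum>i\<le>CARD('n).
    of_nat (lie_algebra.num_ideals_codim (*s) br i) * (of_nat CARD('f) powr (-s)) ^ i)"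
  by (simp add: ideal_zeta_def card_cart_basis)

end

lemma zeta_dim_1:
  fixes br :: "'f::{field,finite} ^ 1 \<Rightarrow> 'f ^ 1 \<Rightarrow> 'f ^ 1"
  assumes "fin_dim_lie_algebra_Fq (*s) br"
  shows "zeta_of br s = 1 + of_nat CARD('f) powr (-s)"
proof -
  have L: "lie_algebra (*s) br" using assms by (rule fin_dim_lie_algebra_Fq.axioms(1))
  show ?thesis
    using num_ideals_codim_0[OF L] num_ideals_codim_full[OF L] by (simp add: zeta_eq_sum[OF assms])
qed

text \<open>Lines in a plane are hyperplanes, so the middle coefficient can be taken in annihilator
  form, a linear condition on \<open>w\<close>.\<close>

lemma zeta_dim_2:
  fixes br :: "'f::{field,finite} ^ 2 \<Rightarrow> 'f ^ 2 \<Rightarrow> 'f ^ 2"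
  assumes "fin_dim_lie_algebra_Fq (*s) br" "t = of_nat CARD('f) powr (-s)"
  shows "zeta_of br s
    = 1 + of_nat (card {w \<in> normalized. \<forall>x y. dot w (br x y) = 0}) * t + t ^ 2"
proof -
  have L: "lie_algebra (*s) br" using assms(1) by (rule fin_dim_lie_algebra_Fq.axioms(1))
  show ?thesis
    using num_ideals_codim_0[OF L] num_ideals_codim_1[OF L] num_ideals_codim_full[OF L]
    by (simp add: zeta_eq_sum[OF assms(1)] assms(2) eval_nat_numeral)
qed

lemma zeta_dim_3:
  fixes br :: "'f::{field,finite} ^ 3 \<Rightarrow> 'f ^ 3 \<Rightarrow> 'f ^ 3"
  assumes "fin_dim_lie_algebra_Fq (*s) br" "t = of_nat CARD('f) powr (-s)"
  shows "zeta_of br s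
    = 1 + of_nat (card {w \<in> normalized. \<forall>x y. dot w (br x y) = 0}) * t
      + of_nat (card {v \<in> normalized. \<forall>x. \<exists>c. br x v = c *s v}) * t ^ 2 + t ^ 3"
proof -
  have L: "lie_algebra (*s) br" using assms(1) by (rule fin_dim_lie_algebra_Fq.axioms(1))
  show ?thesis
    using num_ideals_codim_0[OF L] num_ideals_codim_1[OF L] num_ideals_dim_1[OF L, of 2]
      num_ideals_codim_full[OF L]
    by (simp add: zeta_eq_sum[OF assms(1)] assms(2) eval_nat_numeral)
qed

section \<open>Annihilators and common eigenvectors of the given algebras\<close>

lemma abelian_brackets: "L11 x y = 0" "L21 x' y' = 0" "L1 x'' y'' = 0"
  by (simp_all add: L_defs bracket_of_def)

lemma L22_component: "L22 x y $ 1 = 0" "L22 x y $ 2 = x $ 1 * y $ 2 - x $ 2 * y $ 1"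
  by (simp_all add: L22_def bracket_of_def sum_2 axis_def algebra_simps)

lemma L2_component:
  "L2 x y $ 1 = x $ 3 * y $ 1 - x $ 1 * y $ 3" "L2 x y $ 2 = x $ 3 * y $ 2 - x $ 2 * y $ 3"
  "L2 x y $ 3 = 0"
  by (simp_all add: L2_def bracket_of_def sum_3 axis_def algebra_simps)

lemma L3_component:
  "L3 a x y $ 1 = a * (x $ 3 * y $ 2 - x $ 2 * y $ 3)"
  "L3 a x y $ 2 = x $ 3 * y $ 1 - x $ 1 * y $ 3 + (x $ 3 * y $ 2 - x $ 2 * y $ 3)"
  "L3 a x y $ 3 = 0"
  by (simp_all add: L3_def bracket_of_def sum_3 axis_def algebra_simps)

lemma L4_component:
  "L4 a x y $ 1 = a * (x $ 3 * y $ 2 - x $ 2 * y $ 3)"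
  "L4 a x y $ 2 = x $ 3 * y $ 1 - x $ 1 * y $ 3"
  "L4 a x y $ 3 = 0"
  by (simp_all add: L4_def bracket_of_def sum_3 axis_def algebra_simps)

text \<open>The derived algebra is spanned by \<open>basis_e 2\<close>.\<close>

lemma L22_annihilator: "(\<forall>x y. dot w (L22 x y) = 0) \<longleftrightarrow> w $ 2 = 0"
proof
  assume "\<forall>x y. dot w (L22 x y) = 0"
  then have "dot w (L22 (basis_e 1) (basis_e 2)) = 0" by blast
  then show "w $ 2 = 0" by (simp add: L_brackets dot_axis)
qed (simp add: dot_def sum_2 L22_component)

lemma L2_annihilator: "(\<forall>x y. dot w (L2 x y) = 0) \<longleftrightarrow> w $ 1 = 0 \<and> w $ 2 = 0"
proof
  assume "\<forall>x y. dot w (L2 x y) = 0"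
  then have "dot w (L2 (basis_e 3) (basis_e 1)) = 0" "dot w (L2 (basis_e 3) (basis_e 2)) = 0"
    by blast+
  then show "w $ 1 = 0 \<and> w $ 2 = 0" by (simp add: L_brackets dot_axis)
qed (simp add: dot_def sum_3 L2_component)

text \<open>The derived algebra is spanned by \<open>basis_e 2\<close> and
  \<open>a *s basis_e 1\<close>. Keeping the factor \<open>a\<close> lets one statement serve both
  zero and nonzero \<open>a\<close>.\<close>

lemma L3_annihilator: "(\<forall>x y. dot w (L3 a x y) = 0) \<longleftrightarrow> a * w $ 1 = 0 \<and> w $ 2 = 0"
proof
  assume "\<forall>x y. dot w (L3 a x y) = 0"
  then have "dot w (L3 a (basis_e 3) (basis_e 1)) = 0" "dot w (L3 a (basis_e 3) (basis_e 2)) = 0"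
    by blast+
  then show "a * w $ 1 = 0 \<and> w $ 2 = 0" by (simp add: L_brackets dot_axis dot_linear)
qed (auto simp: dot_def sum_3 L3_component)

lemma L4_annihilator: "(\<forall>x y. dot w (L4 a x y) = 0) \<longleftrightarrow> a * w $ 1 = 0 \<and> w $ 2 = 0"
proof
  assume "\<forall>x y. dot w (L4 a x y) = 0"
  then have "dot w (L4 a (basis_e 3) (basis_e 1)) = 0" "dot w (L4 a (basis_e 3) (basis_e 2)) = 0"
    by blast+
  then show "a * w $ 1 = 0 \<and> w $ 2 = 0" by (simp add: L_brackets dot_axis dot_linear)
qed (auto simp: dot_def sum_3 L4_component)

lemma L2_eigenvector: "(\<forall>x. \<exists>c. L2 x v = c *s v) \<longleftrightarrow> v $ 3 = 0"
proof
  assume "\<forall>x. \<exists>c. L2 x v = c *s v"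
  then obtain c where "L2 (basis_e 1) v = c *s v" by blast
  \<comment> \<open>The bracket is \<open>- v $ 3\<close> times \<open>basis_e 1\<close>. Its third
    component is 0, so a nonzero \<open>v $ 3\<close> would force \<open>c = 0\<close>, and then the
    first component would give \<open>v $ 3 = 0\<close>.\<close>
  then show "v $ 3 = 0" by (auto simp: vec_eq_iff forall_3 L2_component axis_def)
next
  assume "v $ 3 = 0"
  then have "L2 x v = x $ 3 *s v" for x by (simp add: vec_eq_iff forall_3 L2_component)
  then show "\<forall>x. \<exists>c. L2 x v = c *s v" by blast
qed

text \<open>Bracketing with \<open>basis_e 1\<close> forces \<open>v $ 3 = 0\<close>. On that plane
  the bracket with \<open>x\<close> is \<open>x $ 3\<close> times the bracket with
  \<open>basis_e 3\<close>, so only the eigenvector equation for \<open>basis_e 3\<close>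
  remains.\<close>

lemma L3_eigenvector:
  "(\<forall>x. \<exists>c. L3 a x v = c *s v)
    \<longleftrightarrow> v $ 3 = 0 \<and> (\<exists>c. a * v $ 2 = c * v $ 1 \<and> v $ 1 + v $ 2 = c * v $ 2)"
proof
  assume "\<forall>x. \<exists>c. L3 a x v = c *s v"
  then obtain c d where "L3 a (basis_e 1) v = c *s v" "L3 a (basis_e 3) v = d *s v" by blast
  then show "v $ 3 = 0 \<and> (\<exists>c. a * v $ 2 = c * v $ 1 \<and> v $ 1 + v $ 2 = c * v $ 2)"
    by (auto simp: vec_eq_iff forall_3 L3_component axis_def)
next
  assume "v $ 3 = 0 \<and> (\<exists>c. a * v $ 2 = c * v $ 1 \<and> v $ 1 + v $ 2 = c * v $ 2)"
  then obtain c where c: "v $ 3 = 0" "a * v $ 2 = c * v $ 1" "v $ 1 + v $ 2 = c * v $ 2" by blast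
  have "L3 a x v = (x $ 3 * c) *s v" for x
    using c by (simp add: vec_eq_iff forall_3 L3_component mult.left_commute[of a] mult.assoc
        flip: distrib_left)
  then show "\<forall>x. \<exists>c. L3 a x v = c *s v" by blast
qed

lemma L4_eigenvector:
  "(\<forall>x. \<exists>c. L4 a x v = c *s v)
    \<longleftrightarrow> v $ 3 = 0 \<and> (\<exists>c. a * v $ 2 = c * v $ 1 \<and> v $ 1 = c * v $ 2)"
proof
  assume "\<forall>x. \<exists>c. L4 a x v = c *s v"
  then obtain c d where "L4 a (basis_e 1) v = c *s v" "L4 a (basis_e 3) v = d *s v" by blast
  then show "v $ 3 = 0 \<and> (\<exists>c. a * v $ 2 = c * v $ 1 \<and> v $ 1 = c * v $ 2)"
    by (auto simp: vec_eq_iff forall_3 L4_component axis_def)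
next
  assume "v $ 3 = 0 \<and> (\<exists>c. a * v $ 2 = c * v $ 1 \<and> v $ 1 = c * v $ 2)"
  then obtain c where c: "v $ 3 = 0" "a * v $ 2 = c * v $ 1" "v $ 1 = c * v $ 2" by blast
  have "L4 a x v = (x $ 3 * c) *s v" for x
    using c by (simp add: vec_eq_iff forall_3 L4_component mult.left_commute[of a] mult.assoc)
  then show "\<forall>x. \<exists>c. L4 a x v = c *s v" by blast
qed

section \<open>Counts of annihilators and eigenvectors\<close>

lemma card_normalized_3_axis_3:
  "card {w \<in> normalized :: ('f::field ^ 3) set. w $ 1 = 0 \<and> w $ 2 = 0} = 1"
proof -
  have "{w \<in> normalized :: ('f ^ 3) set. w $ 1 = 0 \<and> w $ 2 = 0} = {basis_e 3}"
    by (auto simp: normalized_3 vec_eq_iff forall_3 axis_def)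
  then show ?thesis by simp
qed

text \<open>These are the annihilators of \<open>basis_e 2\<close>, which spans the derived algebras
  of \<open>L3 0\<close> and \<open>L4 0\<close>.\<close>

lemma card_normalized_3_plane_13:
  "card {w \<in> normalized :: ('f::{field,finite} ^ 3) set. w $ 2 = 0} = 1 + CARD('f)"
proof -
  have "{w \<in> normalized :: ('f ^ 3) set. w $ 2 = 0}
      = insert (vector [1, 0, 0]) (range (\<lambda>x. vector [x, 0, 1]))"
    by (auto simp: normalized_3 image_iff vec_eq_iff forall_3)
  moreover have "vector [1, 0, 0] \<notin> range (\<lambda>x. vector [x, 0, 1] :: 'f ^ 3)"
    by (auto simp: vec_eq_iff forall_3)
  moreover have "card (range (\<lambda>x. vector [x, 0, 1] :: 'f ^ 3)) = CARD('f)"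
    by (intro card_image injI) (simp add: vec_eq_iff forall_3)
  ultimately show ?thesis
    by (simp only: card_insert_disjoint finite plus_1_eq_Suc not_False_eq_True)
qed

text \<open>These vectors represent the lines in the plane of \<open>basis_e 1\<close> and
  \<open>basis_e 2\<close>, all of which are ideals of \<open>L2\<close>.\<close>

lemma card_normalized_3_plane_12:
  "card {v \<in> normalized :: ('f::{field,finite} ^ 3) set. v $ 3 = 0} = 1 + CARD('f)"
proof -
  have "{v \<in> normalized :: ('f ^ 3) set. v $ 3 = 0}
      = insert (vector [0, 1, 0]) (range (\<lambda>x. vector [1, x, 0]))"
    by (auto simp: normalized_3 image_iff vec_eq_iff forall_3)
  moreover have "vector [0, 1, 0] \<notin> range (\<lambda>x. vector [1, x, 0] :: 'f ^ 3)"
    by (auto simp: vec_eq_iff forall_3)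
  moreover have "card (range (\<lambda>x. vector [1, x, 0] :: 'f ^ 3)) = CARD('f)"
    by (intro card_image injI) (simp add: vec_eq_iff forall_3)
  ultimately show ?thesis
    by (simp only: card_insert_disjoint finite plus_1_eq_Suc not_False_eq_True)
qed

text \<open>For \<open>(1, x, 0)\<close> the first eigenvector equation gives
  \<open>c = a * x\<close>, and the second becomes \<open>1 + x = a * x ^ 2\<close>, which defines
  \<open>V3 a\<close>. The vector \<open>(0, 1, 0)\<close> would need \<open>a = 0\<close>.\<close>

lemma card_L3_eigenvectors:
  fixes a :: "'f::field"
  assumes "a \<noteq> 0"
  shows "card {v \<in> normalized. \<forall>x. \<exists>c. L3 a x v = c *s v} = card (V3 a)"
proof -
  have "{v \<in> normalized. \<forall>x. \<exists>c. L3 a x v = c *s v} = (\<lambda>x. vector [1, x, 0]) ` V3 a"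
    using assms unfolding L3_eigenvector
    by (auto simp: normalized_3 V3_def image_iff vec_eq_iff forall_3
        power2_eq_square algebra_simps)
  moreover have "inj_on (\<lambda>x. vector [1, x, 0] :: 'f ^ 3) (V3 a)"
    by (intro inj_onI) (simp add: vec_eq_iff forall_3)
  ultimately show ?thesis by (simp only: card_image)
qed

text \<open>On the plane of the first two basis vectors, bracketing with \<open>basis_e 3\<close>
  has the eigenvalues 0 and 1, each with one eigenline.\<close>

lemma card_L3_0_eigenvectors:
  "card {v \<in> normalized :: ('f::field ^ 3) set. \<forall>x. \<exists>c. L3 0 x v = c *s v} = 2"
proof -
  have "{v \<in> normalized :: ('f ^ 3) set. \<forall>x. \<exists>c. L3 0 x v = c *s v}
      = {vector [1, -1, 0], vector [0, 1, 0]}"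
    unfolding L3_eigenvector
    by (auto simp: normalized_3 vec_eq_iff forall_3 eq_neg_iff_add_eq_0 add.commute)
  moreover have "vector [1, -1, 0] \<noteq> (vector [0, 1, 0] :: 'f ^ 3)"
    by (simp add: vec_eq_iff forall_3)
  ultimately show ?thesis by (simp only: card_2_iff) blast
qed

text \<open>Again \<open>c = a * x\<close> for \<open>(1, x, 0)\<close>, and the second equation now
  reads \<open>1 = a * x ^ 2\<close>.\<close>

lemma card_L4_eigenvectors:
  fixes a :: "'f::field"
  assumes "a \<noteq> 0"
  shows "card {v \<in> normalized. \<forall>x. \<exists>c. L4 a x v = c *s v} = card (V4 a)"
proof -
  have "{v \<in> normalized. \<forall>x. \<exists>c. L4 a x v = c *s v} = (\<lambda>x. vector [1, x, 0]) ` V4 a"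
    using assms unfolding L4_eigenvector
    by (auto simp: normalized_3 V4_def image_iff vec_eq_iff forall_3
        power2_eq_square algebra_simps)
      (metis mult.assoc mult.right_neutral)
  moreover have "inj_on (\<lambda>x. vector [1, x, 0] :: 'f ^ 3) (V4 a)"
    by (intro inj_onI) (simp add: vec_eq_iff forall_3)
  ultimately show ?thesis by (simp only: card_image)
qed

text \<open>Bracketing with \<open>basis_e 3\<close> sends \<open>basis_e 1\<close> to
  \<open>basis_e 2\<close> and \<open>basis_e 2\<close> to 0. On their plane this is nilpotent and
  nonzero, so it has a single eigenline.\<close>

lemma card_L4_0_eigenvectors:
  "card {v \<in> normalized :: ('f::field ^ 3) set. \<forall>x. \<exists>c. L4 0 x v = c *s v} = 1"
proof -
  have "{v \<in> normalized :: ('f ^ 3) set. \<forall>x. \<exists>c. L4 0 x v = c *s v} = {vector [0, 1, 0]}"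
    unfolding L4_eigenvector
    by (auto simp: normalized_3 vec_eq_iff forall_3)
  then show ?thesis by simp
qed

section \<open>The nine zeta functions\<close>

theorem theorem1p6:
  fixes a :: "'f::{field,finite}"
    and s t :: complex
    and q :: nat
  assumes "a \<noteq> 0"
    and "q = CARD('f)"
    and "t = of_nat q powr (-s)"
  shows "zeta_of (L11 :: 'f ^ 1 \<Rightarrow> _) s = 1 + t
    \<and> zeta_of (L21 :: 'f ^ 2 \<Rightarrow> _) s = 1 + (1 + of_nat q) * t + t ^ 2
    \<and> zeta_of (L22 :: 'f ^ 2 \<Rightarrow> _) s = 1 + t + t ^ 2
    \<and> zeta_of (L1 :: 'f ^ 3 \<Rightarrow> _) s
      = 1 + (1 + of_nat q + of_nat q ^ 2) * t + (1 + of_nat q + of_nat q ^ 2) * t ^ 2 + t ^ 3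
    \<and> zeta_of (L2 :: 'f ^ 3 \<Rightarrow> _) s = 1 + t + (1 + of_nat q) * t ^ 2 + t ^ 3
    \<and> zeta_of (L3 a) s = 1 + t + of_nat (card (V3 a)) * t ^ 2 + t ^ 3
    \<and> zeta_of (L3 (0 :: 'f)) s = 1 + (1 + of_nat q) * t + 2 * t ^ 2 + t ^ 3
    \<and> zeta_of (L4 a) s = 1 + t + of_nat (card (V4 a)) * t ^ 2 + t ^ 3
    \<and> zeta_of (L4 (0 :: 'f)) s = 1 + (1 + of_nat q) * t + t ^ 2 + t ^ 3"
proof (intro conjI)
  have t: "t = of_nat CARD('f) powr (-s)" using assms by simp
  note zeta_2 = zeta_dim_2[OF _ t] and zeta_3 = zeta_dim_3[OF _ t]
  show "zeta_of (L11 :: 'f ^ 1 \<Rightarrow> _) s = 1 + t"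
    unfolding zeta_dim_1[OF fin_dim_lie_algebras(1)] t ..
  show "zeta_of (L21 :: 'f ^ 2 \<Rightarrow> _) s = 1 + (1 + of_nat q) * t + t ^ 2"
    unfolding zeta_2[OF fin_dim_lie_algebras(2)] abelian_brackets
    by (simp add: dot_def card_normalized_2 assms(2))
  have "{w \<in> normalized :: ('f ^ 2) set. w $ 2 = 0} = {basis_e 1}"
    by (auto simp: normalized_2 vec_eq_iff forall_2 axis_def)
  then show "zeta_of (L22 :: 'f ^ 2 \<Rightarrow> _) s = 1 + t + t ^ 2"
    unfolding zeta_2[OF fin_dim_lie_algebras(3)] L22_annihilator by simp
  \<comment> \<open>In the abelian algebra every vector is a common eigenvector with eigenvalue 0,
    so all lines count.\<close>
  have "\<exists>c. 0 = c *s v" for v :: "'f ^ 3" by (intro exI[of _ 0]) simp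
  then show "zeta_of (L1 :: 'f ^ 3 \<Rightarrow> _) s
      = 1 + (1 + of_nat q + of_nat q ^ 2) * t + (1 + of_nat q + of_nat q ^ 2) * t ^ 2 + t ^ 3"
    unfolding zeta_3[OF fin_dim_lie_algebras(4)] abelian_brackets
    by (simp add: dot_def card_normalized_3 assms(2) add.assoc)
  show "zeta_of (L2 :: 'f ^ 3 \<Rightarrow> _) s = 1 + t + (1 + of_nat q) * t ^ 2 + t ^ 3"
    unfolding zeta_3[OF fin_dim_lie_algebras(5)] L2_annihilator L2_eigenvector
      card_normalized_3_axis_3 card_normalized_3_plane_12
    by (simp add: assms(2))
  \<comment> \<open>As \<open>a\<close> is nonzero, \<open>a * w $ 1 = 0\<close> means
    \<open>w $ 1 = 0\<close>, which leaves one hyperplane.\<close>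
  show "zeta_of (L3 a) s = 1 + t + of_nat (card (V3 a)) * t ^ 2 + t ^ 3"
    unfolding zeta_3[OF fin_dim_lie_algebras(6)] card_L3_eigenvectors[OF assms(1)]
    using assms(1) card_normalized_3_axis_3[where ?'f = 'f] by (simp add: L3_annihilator)
  \<comment> \<open>For parameter 0 the condition on \<open>w $ 1\<close> becomes vacuous, and
    \<open>w $ 2 = 0\<close> leaves q + 1 hyperplanes.\<close>
  show "zeta_of (L3 (0 :: 'f)) s = 1 + (1 + of_nat q) * t + 2 * t ^ 2 + t ^ 3"
    unfolding zeta_3[OF fin_dim_lie_algebras(6)] card_L3_0_eigenvectors
    using card_normalized_3_plane_13[where ?'f = 'f] by (simp add: L3_annihilator assms(2))
  show "zeta_of (L4 a) s = 1 + t + of_nat (card (V4 a)) * t ^ 2 + t ^ 3"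
    unfolding zeta_3[OF fin_dim_lie_algebras(7)] card_L4_eigenvectors[OF assms(1)]
    using assms(1) card_normalized_3_axis_3[where ?'f = 'f] by (simp add: L4_annihilator)
  show "zeta_of (L4 (0 :: 'f)) s = 1 + (1 + of_nat q) * t + t ^ 2 + t ^ 3"
    unfolding zeta_3[OF fin_dim_lie_algebras(7)] card_L4_0_eigenvectors
    using card_normalized_3_plane_13[where ?'f = 'f] by (simp add: L4_annihilator assms(2))
qed

end
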